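(* Let $G$ be a connected graph of order $n\ge 2$ with vertex set $\{v_1,\ldots,v_n\}$ and $d_{i,j}=d(v_i,v_j)$. Then $$\partial_1^{L}(G)\le \frac{1}{2}\max_{1\le i<j\le n}\Big\{Tr(v_i)+Tr(v_j)+2d_{i,j}+\sum_{k\ne i,\,k\neq j}|d_{i,k}-d_{j,k}|\Big\},$$ and the right-hand side of this inequality does not exceed $\sum_{i=1}^{n}p_i$, where $p_i=\max_{j\ne i}d_{i,j}$ for $i=1,\ldots,n$.
   Context: Graphs are finite, simple and undirected. For a connected graph $G$ with vertices $v_1,\ldots,v_n$, $d(u,v)$ is the length of a shortest path between $u$ and $v$; the distance matrix is $\mathcal{D}(G)=(d_{i,j})$ with $d_{i,j}=d(v_i,v_j)$; the transmission of a vertex is $Tr(v)=\sum_{u\in V(G)}d(v,u)$; $Tr(G)=\mathrm{diag}[Tr(v_1),\ldots,Tr(v_n)]$. The distance Laplacian matrix is $\mathcal{L}(G)=Tr(G)-\mathcal{D}(G)$, with eigenvalues $\partial_1^{L}(G)\ge\cdots\ge\partial_n^{L}(G)$. *)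

theory Defs
  imports "Graph_Theory.Digraph_Component" "Jordan_Normal_Form.Char_Poly"
begin

text \<open>
  Finite simple undirected graphs are the locale \<open>graph\<close>: finite, loop-free,
  symmetric digraphs without parallel arcs, so that an edge is a pair of opposite arcs.
  A vertex enumeration \<open>v\<close> is indexed from 0, like matrix rows and columns: \<open>v 0, \<dots>, v (n - 1)\<close>.
\<close>

text \<open>Only meaningful if some path joins the two vertices, as in a connected graph.\<close>

definition gdist :: "('a, 'b) pre_digraph \<Rightarrow> 'a \<Rightarrow> 'a \<Rightarrow> nat" where
  "gdist G u w = (LEAST l. \<exists>p. pre_digraph.apath G u p w \<and> length p = l)"

definition transmission :: "('a, 'b) pre_digraph \<Rightarrow> 'a \<Rightarrow> nat" where
  "transmission G w = (\<Sum>u\<in>verts G. gdist G w u)"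

definition distance_matrix :: "('a, 'b) pre_digraph \<Rightarrow> nat \<Rightarrow> (nat \<Rightarrow> 'a) \<Rightarrow> real mat" where
  "distance_matrix G n v = mat n n (\<lambda>(i, j). real (gdist G (v i) (v j)))"

definition transmission_matrix :: "('a, 'b) pre_digraph \<Rightarrow> nat \<Rightarrow> (nat \<Rightarrow> 'a) \<Rightarrow> real mat" where
  "transmission_matrix G n v = mat_diag n (\<lambda>i. real (transmission G (v i)))"

definition distance_laplacian :: "('a, 'b) pre_digraph \<Rightarrow> nat \<Rightarrow> (nat \<Rightarrow> 'a) \<Rightarrow> real mat" where
  "distance_laplacian G n v = transmission_matrix G n v - distance_matrix G n v"

text \<open>
  The real eigenvalues in non-increasing order, repeated according to algebraic multiplicity.
  For a symmetric matrix the characteristic polynomial splits over the reals, so the list has as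
  many entries as the matrix has rows; the largest eigenvalue is entry 0.
\<close>

definition real_eigenvalues :: "real mat \<Rightarrow> real list" where
  "real_eigenvalues A = rev (sorted_list_of_multiset (proots (char_poly A)))"

lemma sorted_real_eigenvalues: "sorted_wrt (\<ge>) (real_eigenvalues A)"
proof -
  have "sorted_wrt (\<le>) (sorted_list_of_multiset (proots (char_poly A)))"
    by simp
  then show ?thesis
    unfolding real_eigenvalues_def by (simp add: sorted_wrt_rev)
qed

lemma set_real_eigenvalues:
  assumes "A \<in> carrier_mat n n"
  shows "set (real_eigenvalues A) = {x. eigenvalue A x}"
proof -
  have "char_poly A \<noteq> 0"
    using degree_monic_char_poly[OF assms] by auto
  then show ?thesis
    by (simp add: real_eigenvalues_def eigenvalue_root_char_poly[OF assms])
qed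

end

theory Submission
  imports Defs
begin

text \<open>
  Let \<open>x\<close> be a real eigenvector of the distance Laplacian for the eigenvalue \<open>\<mu>\<close>. Row \<open>i\<close> of the
  eigenvalue equation reads \<open>\<mu> x\<^sub>i = \<Sum>k. d\<^sub>i\<^sub>k (x\<^sub>i - x\<^sub>k)\<close>. Let \<open>x\<^sub>i\<close> be the largest and
  \<open>x\<^sub>j\<close> the smallest entry of \<open>x\<close>, and subtract the two rows:
  \<open>\<mu> (x\<^sub>i - x\<^sub>j) = \<Sum>k. (d\<^sub>i\<^sub>k (x\<^sub>i - x\<^sub>k) + d\<^sub>j\<^sub>k (x\<^sub>k - x\<^sub>j))\<close>.
  Each of the terms \<open>k = i\<close> and \<open>k = j\<close> equals \<open>d\<^sub>i\<^sub>j (x\<^sub>i - x\<^sub>j)\<close>. In every other term both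
  differences are nonnegative and add up to \<open>x\<^sub>i - x\<^sub>j\<close>, so the term is at most
  \<open>max d\<^sub>i\<^sub>k d\<^sub>j\<^sub>k (x\<^sub>i - x\<^sub>j)\<close>. Dividing by \<open>x\<^sub>i - x\<^sub>j\<close> gives
  \<open>\<mu> \<le> 2 d\<^sub>i\<^sub>j + \<Sum>k\<notin>{i,j}. max d\<^sub>i\<^sub>k d\<^sub>j\<^sub>k\<close>; if \<open>x\<close> is constant, then \<open>\<mu> = 0\<close>.
  This is \<open>weighted_laplacian_eigenvalue_le\<close>.

  Since \<open>2 max a b = a + b + \<bar>a - b\<bar>\<close>, the right-hand side is half of the expression for the pair
  \<open>i, j\<close> in the theorem (\<open>pair_expression_eq_max_sum\<close>). The form with the maximum also yields the
  second inequality: \<open>d\<^sub>i\<^sub>j\<close> is bounded by both \<open>p\<^sub>i\<close> and \<open>p\<^sub>j\<close>, and each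
  \<open>max d\<^sub>i\<^sub>k d\<^sub>j\<^sub>k\<close> by \<open>p\<^sub>k\<close>.

  The argument bounds every real eigenvalue. Entry 0 of the list of real eigenvalues is one of them
  because the list is nonempty: the all-ones vector is an eigenvector for the eigenvalue 0.
\<close>

section \<open>Distances in symmetric digraphs\<close>

text \<open>Replacing each arc by an opposite one, in reverse order, reverses the vertex sequence.\<close>

lemma (in sym_digraph) awalk_reverse:
  assumes "awalk u p w"
  shows "\<exists>q. awalk w q u \<and> awalk_verts w q = rev (awalk_verts u p)"
  using assms
proof (induction p arbitrary: u)
  case Nil
  then show ?case
    by (intro exI[of _ "[]"]) (auto simp: awalk_Nil_iff)
next
  case (Cons e es)
  then have e: "e \<in> arcs G" "tail G e = u" and es: "awalk (head G e) es w"
    by (auto simp: awalk_Cons_iff)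
  from Cons.IH[OF es] obtain q where
    q: "awalk w q (head G e)" "awalk_verts w q = rev (awalk_verts (head G e) es)"
    by blast
  obtain e' where e': "e' \<in> arcs G" "tail G e' = head G e" "head G e' = tail G e"
    using sym_arcs e(1) unfolding symmetric_conv by metis
  have last: "awlast w q = head G e"
    using q(1) by auto
  have "awalk (head G e) [e'] u"
    using e e' by (auto simp: awalk_simps)
  then have "awalk w (q @ [e']) u"
    using q(1) by (rule awalk_appendI[rotated])
  moreover from this have "awalk_verts w (q @ [e']) = rev (awalk_verts u (e # es))"
    using q(2) e e' last by (auto simp: awalk_verts_append)
  ultimately show ?case
    by blast
qed

lemma (in sym_digraph) apath_reverse:
  assumes "apath u p w"
  shows "\<exists>q. apath w q u \<and> length q = length p"
proof -
  from assms obtain q where q: "awalk w q u" "awalk_verts w q = rev (awalk_verts u p)"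
    using awalk_reverse unfolding apath_def by blast
  moreover from q(2) have "length q = length p"
    by (metis length_awalk_verts length_rev nat.inject)
  ultimately show ?thesis
    using assms unfolding apath_def by auto
qed

lemma (in sym_digraph) gdist_commute: "gdist G u w = gdist G w u"
proof -
  have "(\<exists>p. apath u p w \<and> length p = l) \<longleftrightarrow> (\<exists>p. apath w p u \<and> length p = l)" for l
    using apath_reverse by metis
  then show ?thesis
    unfolding gdist_def by simp
qed

lemma (in wf_digraph) gdist_self:
  assumes "u \<in> verts G"
  shows "gdist G u u = 0"
proof -
  have "apath u [] u"
    using assms by (simp add: apath_Nil_iff)
  then show ?thesis
    unfolding gdist_def by (intro Least_eq_0) auto
qed

section \<open>Eigenvalues of weighted Laplacians\<close>

text \<open>
  The pair expression counts \<open>w i j\<close> four times, once in each of the two row sums and twice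
  explicitly; the remaining terms combine by \<open>2 max a b = a + b + \<bar>a - b\<bar>\<close>.
\<close>

lemma pair_expression_eq_max_sum:
  fixes w :: "'i \<Rightarrow> 'i \<Rightarrow> real"
  assumes "finite I" "i \<in> I" "j \<in> I" "i \<noteq> j"
    and sym: "w j i = w i j" and diag: "w i i = 0" "w j j = 0"
  shows "(\<Sum>k\<in>I. w i k) + (\<Sum>k\<in>I. w j k) + 2 * w i j + (\<Sum>k\<in>I - {i, j}. \<bar>w i k - w j k\<bar>)
    = 2 * (2 * w i j + (\<Sum>k\<in>I - {i, j}. max (w i k) (w j k)))"
proof -
  have split: "(\<Sum>k\<in>I. f k) = f i + f j + (\<Sum>k\<in>I - {i, j}. f k)" for f :: "'i \<Rightarrow> real"
    using sum.subset_diff[of "{i, j}" I f] assms by auto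
  have "2 * (\<Sum>k\<in>I - {i, j}. max (w i k) (w j k))
    = (\<Sum>k\<in>I - {i, j}. w i k + w j k + \<bar>w i k - w j k\<bar>)"
    unfolding sum_distrib_left by (intro sum.cong) (auto simp: max_def)
  then show ?thesis
    by (simp add: split sum.distrib sym diag)
qed

text \<open>
  The pair \<open>i, j\<close> consists of the positions of a largest and a smallest entry of the eigenvector.
  For a constant eigenvector \<open>\<mu> = 0\<close>, and any pair will do; this is where two indices are needed.
\<close>

lemma weighted_laplacian_eigenvalue_le:
  fixes w :: "'i \<Rightarrow> 'i \<Rightarrow> real"
  assumes fin: "finite I" and two: "a \<in> I" "b \<in> I" "a \<noteq> b"
    and nonneg: "\<And>i k. i \<in> I \<Longrightarrow> k \<in> I \<Longrightarrow> 0 \<le> w i k"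
    and sym: "\<And>i k. i \<in> I \<Longrightarrow> k \<in> I \<Longrightarrow> w i k = w k i"
    and eigen: "\<And>i. i \<in> I \<Longrightarrow> (\<Sum>k\<in>I. w i k * (x i - x k)) = \<mu> * x i"
    and nonzero: "\<exists>i\<in>I. x i \<noteq> 0"
  shows "\<exists>i\<in>I. \<exists>j\<in>I. i \<noteq> j \<and> \<mu> \<le> 2 * w i j + (\<Sum>k\<in>I - {i, j}. max (w i k) (w j k))"
proof -
  have ne: "x ` I \<noteq> {}" and finx: "finite (x ` I)"
    using fin two by auto
  obtain i where i: "i \<in> I" "x i = Max (x ` I)"
    using Max_in[OF finx ne] by auto
  obtain j where j: "j \<in> I" "x j = Min (x ` I)"
    using Min_in[OF finx ne] by auto
  have le_i: "x k \<le> x i" and j_le: "x j \<le> x k" if "k \<in> I" for k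
    using that i j finx by auto
  show ?thesis
  proof (cases "x i = x j")
    case True
    then have const: "x k = x i" if "k \<in> I" for k
      using le_i[OF that] j_le[OF that] by simp
    have "\<mu> * x i = 0"
      using eigen[OF i(1)] const by simp
    moreover have "x i \<noteq> 0"
      using nonzero const by auto
    ultimately have "\<mu> = 0"
      by simp
    moreover have "0 \<le> 2 * w a b + (\<Sum>k\<in>I - {a, b}. max (w a k) (w b k))"
      using two by (intro add_nonneg_nonneg sum_nonneg) (auto simp: nonneg le_max_iff_disj)
    ultimately show ?thesis
      using two by auto
  next
    case False
    let ?M = "\<Sum>k\<in>I - {i, j}. max (w i k) (w j k)"
    let ?t = "\<lambda>k. w i k * (x i - x k) + w j k * (x k - x j)"
    have gap: "0 < x i - x j"
      using le_i[OF j(1)] False by simp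
    have ij: "i \<noteq> j"
      using False by auto
    have term_le: "?t k \<le> max (w i k) (w j k) * (x i - x j)" if "k \<in> I" for k
    proof -
      have "?t k \<le> max (w i k) (w j k) * (x i - x k) + max (w i k) (w j k) * (x k - x j)"
        using le_i[OF that] j_le[OF that] by (intro add_mono mult_right_mono) auto
      then show ?thesis
        by (simp add: algebra_simps)
    qed
    have "\<mu> * (x i - x j) = (\<Sum>k\<in>I. w i k * (x i - x k)) - (\<Sum>k\<in>I. w j k * (x j - x k))"
      using eigen[OF i(1)] eigen[OF j(1)] by (simp add: right_diff_distrib)
    also have "\<dots> = (\<Sum>k\<in>I. ?t k)"
      unfolding sum_subtractf[symmetric] by (intro sum.cong) (auto simp: algebra_simps)
    also have "\<dots> = ?t i + ?t j + (\<Sum>k\<in>I - {i, j}. ?t k)"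
      using sum.subset_diff[of "{i, j}" I ?t] fin i(1) j(1) ij by auto
    also have "\<dots> = 2 * w i j * (x i - x j) + (\<Sum>k\<in>I - {i, j}. ?t k)"
      using sym[OF i(1) j(1)] by simp
    also have "\<dots> \<le> 2 * w i j * (x i - x j) + ?M * (x i - x j)"
      unfolding sum_distrib_right using term_le by (intro add_left_mono sum_mono) auto
    also have "\<dots> = (2 * w i j + ?M) * (x i - x j)"
      by (simp add: algebra_simps)
    finally have "\<mu> \<le> 2 * w i j + ?M"
      using gap by simp
    then show ?thesis
      using i(1) j(1) ij by blast
  qed
qed

section \<open>The distance Laplacian\<close>

lemma distance_laplacian_carrier [simp]: "distance_laplacian G n v \<in> carrier_mat n n"
  by (simp add: distance_laplacian_def distance_matrix_def minus_carrier_mat)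

lemma distance_laplacian_mult_vec:
  assumes bij: "bij_betw v {..<n} (verts G)" and x: "x \<in> carrier_vec n" and i: "i < n"
  shows "(distance_laplacian G n v *\<^sub>v x) $ i
    = (\<Sum>k<n. real (gdist G (v i) (v k)) * (x $ i - x $ k))"
proof -
  have Tr: "real (transmission G (v i)) = (\<Sum>k<n. real (gdist G (v i) (v k)))"
    unfolding transmission_def of_nat_sum by (rule sum.reindex_bij_betw[OF bij, symmetric])
  have "(distance_laplacian G n v *\<^sub>v x) $ i
    = (\<Sum>k<n. ((if i = k then real (transmission G (v i)) else 0)
        - real (gdist G (v i) (v k))) * x $ k)"
    using x i
    by (auto simp: scalar_prod_def distance_laplacian_def transmission_matrix_def
        distance_matrix_def mat_diag_def lessThan_atLeast0 intro!: sum.cong)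
  also have "\<dots> = real (transmission G (v i)) * x $ i
      - (\<Sum>k<n. real (gdist G (v i) (v k)) * x $ k)"
    using i by (simp add: left_diff_distrib sum_subtractf if_distrib[of "\<lambda>y. y * _"] cong: if_cong)
  also have "\<dots> = (\<Sum>k<n. real (gdist G (v i) (v k)) * (x $ i - x $ k))"
    unfolding Tr by (simp add: right_diff_distrib sum_subtractf sum_distrib_right)
  finally show ?thesis .
qed

text \<open>Each row of the distance Laplacian sums to 0, so it annihilates the all-ones vector.\<close>

lemma eigenvalue_zero_distance_laplacian:
  assumes bij: "bij_betw v {..<n} (verts G)" and "0 < n"
  shows "eigenvalue (distance_laplacian G n v) 0"
proof -
  let ?L = "distance_laplacian G n v" and ?x = "vec n (\<lambda>_. 1 :: real)"
  have dim: "dim_row ?L = n"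
    using distance_laplacian_carrier by blast
  have "?L *\<^sub>v ?x = 0 \<cdot>\<^sub>v ?x"
  proof (rule eq_vecI)
    show "(?L *\<^sub>v ?x) $ i = (0 \<cdot>\<^sub>v ?x) $ i" if "i < dim_vec (0 \<cdot>\<^sub>v ?x)" for i
      using that by (subst distance_laplacian_mult_vec[OF bij]) auto
  qed (simp add: dim)
  moreover have "?x \<noteq> 0\<^sub>v n"
  proof
    assume "?x = 0\<^sub>v n"
    then have "?x $ 0 = 0\<^sub>v n $ 0"
      by simp
    with \<open>0 < n\<close> show False
      by simp
  qed
  ultimately have "eigenvector ?L ?x 0"
    unfolding eigenvector_def by (simp add: dim)
  then show ?thesis
    unfolding eigenvalue_def by blast
qed

theorem theorem10:
  fixes G :: "('a, 'b) pre_digraph" and n :: nat and v :: "nat \<Rightarrow> 'a"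
    and d :: "nat \<Rightarrow> nat \<Rightarrow> real" and Tr p :: "nat \<Rightarrow> real" and B :: real
  assumes "graph G" and "connected G"
    and "n = card (verts G)" and "n \<ge> 2"
    and "bij_betw v {..<n} (verts G)"
  defines "d \<equiv> \<lambda>i j. real (gdist G (v i) (v j))"
    and "Tr \<equiv> \<lambda>i. real (transmission G (v i))"
    and "p \<equiv> \<lambda>i. Max {d i j | j. j < n \<and> j \<noteq> i}"
    and "B \<equiv> 1 / 2 * Max {Tr i + Tr j + 2 * d i j + (\<Sum>k\<in>{..<n} - {i, j}. \<bar>d i k - d j k\<bar>)
                | i j. i < j \<and> j < n}"
  shows "real_eigenvalues (distance_laplacian G n v) ! 0 \<le> B \<and> B \<le> (\<Sum>i<n. p i)"
proof -
  interpret graph G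
    by fact
  note bij = \<open>bij_betw v {..<n} (verts G)\<close>
  let ?L = "distance_laplacian G n v"
  define E where "E i j = 2 * d i j + (\<Sum>k\<in>{..<n} - {i, j}. max (d i k) (d j k))" for i j
  define S where
    "S = {Tr i + Tr j + 2 * d i j + (\<Sum>k\<in>{..<n} - {i, j}. \<bar>d i k - d j k\<bar>) | i j. i < j \<and> j < n}"
  have d_sym: "d i k = d k i" for i k
    unfolding d_def by (simp add: gdist_commute)
  have d_diag: "d i i = 0" if "i < n" for i
    unfolding d_def using bij that by (auto simp: gdist_self bij_betw_apply)
  have Tr_sum: "Tr i = (\<Sum>k<n. d i k)" for i
    unfolding Tr_def d_def transmission_def of_nat_sum
    by (rule sum.reindex_bij_betw[OF bij, symmetric])
  have pair: "Tr i + Tr j + 2 * d i j + (\<Sum>k\<in>{..<n} - {i, j}. \<bar>d i k - d j k\<bar>) = 2 * E i j"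
    if "i < j" "j < n" for i j
    unfolding Tr_sum E_def using that
    by (intro pair_expression_eq_max_sum) (auto simp: d_sym d_diag)
  have S_eq: "S = {2 * E i j | i j. i < j \<and> j < n}"
    unfolding S_def by (intro Collect_cong ex_cong1) (metis pair)
  have B_Max: "B = 1 / 2 * Max S"
    unfolding B_def S_def ..
  have "S \<subseteq> (\<lambda>(i, j). 2 * E i j) ` ({..<n} \<times> {..<n})"
    unfolding S_eq by auto
  then have finS: "finite S"
    by (rule finite_subset) simp
  have "2 * E 0 1 \<in> S"
    unfolding S_eq using \<open>n \<ge> 2\<close> by (intro CollectI exI[of _ 0] exI[of _ 1]) simp
  then have neS: "S \<noteq> {}"
    by auto
  have E_sym: "E i j = E j i" for i j
    unfolding E_def by (simp add: d_sym[of i j] max.commute insert_commute)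
  have E_le_B: "E i j \<le> B" if "i < n" "j < n" "i \<noteq> j" for i j
  proof -
    have *: "E i j \<le> B" if "i < j" "j < n" for i j
    proof -
      have "2 * E i j \<in> S"
        unfolding S_eq using that by auto
      then have "2 * E i j \<le> Max S"
        using finS by simp
      then show ?thesis
        unfolding B_Max by simp
    qed
    show ?thesis
      using *[of i j] *[of j i] that E_sym[of i j] by (cases "i < j") auto
  qed
  have eigenvalue_le: "\<mu> \<le> B" if ev: "eigenvalue ?L \<mu>" for \<mu>
  proof -
    obtain x where "eigenvector ?L x \<mu>"
      using ev unfolding eigenvalue_def by blast
    moreover have "dim_row ?L = n"
      using distance_laplacian_carrier by blast
    ultimately have x: "x \<in> carrier_vec n" "x \<noteq> 0\<^sub>v n" "?L *\<^sub>v x = \<mu> \<cdot>\<^sub>v x"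
      unfolding eigenvector_def by auto
    have "\<exists>i\<in>{..<n}. \<exists>j\<in>{..<n}. i \<noteq> j \<and> \<mu> \<le> E i j"
      unfolding E_def
    proof (rule weighted_laplacian_eigenvalue_le[where a = 0 and b = 1 and x = "\<lambda>k. x $ k"])
      show "(\<Sum>k<n. d i k * (x $ i - x $ k)) = \<mu> * x $ i" if "i \<in> {..<n}" for i
        using distance_laplacian_mult_vec[OF bij x(1), of i] x that unfolding d_def by simp
      show "\<exists>i\<in>{..<n}. x $ i \<noteq> 0"
      proof (rule ccontr)
        assume "\<not> ?thesis"
        then have "x = 0\<^sub>v n"
          using x(1) by (intro eq_vecI) auto
        with x(2) show False
          by simp
      qed
      show "d i k = d k i" for i k
        by (rule d_sym)
    qed (use \<open>n \<ge> 2\<close> in \<open>auto simp: d_def\<close>)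
    then show ?thesis
      by (meson E_le_B lessThan_iff order_trans)
  qed
  have set: "set (real_eigenvalues ?L) = {y. eigenvalue ?L y}"
    by (rule set_real_eigenvalues[OF distance_laplacian_carrier])
  then have "0 \<in> set (real_eigenvalues ?L)"
    using eigenvalue_zero_distance_laplacian[OF bij] \<open>n \<ge> 2\<close> by simp
  then have "real_eigenvalues ?L ! 0 \<in> set (real_eigenvalues ?L)"
    by (metis length_pos_if_in_set nth_mem)
  then have first: "real_eigenvalues ?L ! 0 \<le> B"
    using eigenvalue_le set by auto
  have d_le_p: "d i k \<le> p i" if "k < n" "k \<noteq> i" for i k
    unfolding p_def using that by (intro Max_ge) auto
  have E_le: "E i j \<le> (\<Sum>k<n. p k)" if "i < j" "j < n" for i j
  proof -
    \<comment> \<open>Symmetry turns the entries \<open>d i k\<close> and \<open>d j k\<close> of rows \<open>i\<close> and \<open>j\<close> into entries of row \<open>k\<close>.\<close>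
    have "max (d i k) (d j k) \<le> p k" if "k \<in> {..<n} - {i, j}" for k
      using that d_le_p[of i k] d_le_p[of j k] \<open>i < j\<close> \<open>j < n\<close> d_sym[of i k] d_sym[of j k] by auto
    then have "(\<Sum>k\<in>{..<n} - {i, j}. max (d i k) (d j k)) \<le> (\<Sum>k\<in>{..<n} - {i, j}. p k)"
      by (rule sum_mono)
    moreover have "2 * d i j \<le> p i + p j"
      using d_le_p[of j i] d_le_p[of i j] d_sym[of i j] that by auto
    moreover have "(\<Sum>k<n. p k) = p i + p j + (\<Sum>k\<in>{..<n} - {i, j}. p k)"
      using sum.subset_diff[of "{i, j}" "{..<n}" p] that by auto
    ultimately show ?thesis
      unfolding E_def by linarith
  qed
  have "Max S \<le> 2 * (\<Sum>k<n. p k)"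
  proof -
    obtain i j where "Max S = 2 * E i j" "i < j" "j < n"
      using Max_in[OF finS neS] unfolding S_eq by blast
    then show ?thesis
      using E_le[of i j] by simp
  qed
  then have "B \<le> (\<Sum>i<n. p i)"
    unfolding B_Max by simp
  with first show ?thesis
    by blast
qed

end
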